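(* Let $\mathcal{L}$ be a logic having the parallel interpolation property (PIP), and let $\mathcal{T}_1$ and $\mathcal{T}_2$ be two $\Delta$-inseparable sets of formulas in $\mathcal{L}$ with $\mathrm{sig}(\mathcal{T}_1)\cap\mathrm{sig}(\mathcal{T}_2)=\Delta$, for a signature $\Delta$. Let $\sigma$ be a subsignature of $\Delta$ and suppose $\mathrm{forget}(\mathcal{T}_1,\sigma)$ and $\mathrm{forget}(\mathcal{T}_2,\sigma)$ are sets of formulas of $\mathcal{L}$. Then $\mathrm{forget}(\mathcal{T}_1,\sigma)$ and $\mathrm{forget}(\mathcal{T}_2,\sigma)$ are $\Delta$-inseparable.
   Context: $\mathcal{L}$ is a (possibly many-sorted) logic that is a fragment (a set of sentences) of second-order logic with standard Tarskian semantics. A signature is a set of non-logical symbols (equality is logical); $\mathrm{sig}(\cdot)$ is the set of non-logical symbols occurring in a formula or set of formulas. Theories (sets of formulas) consist of sentences. $\mathrm{Cons}(\mathcal{T},\Delta)=\{\varphi\in\mathcal{L}\mid\mathcal{T}\models\varphi,\ \mathrm{sig}(\varphi)\subseteq\Delta\}$; $\mathcal{T}_1,\mathcal{T}_2$ are $\Delta$-inseparable if $\mathrm{Cons}(\mathcal{T}_1,\Delta)=\mathrm{Cons}(\mathcal{T}_2,\Delta)$. PIP: for any theories $\mathcal{T}_1,\mathcal{T}_2$ in $\mathcal{L}$ with $\mathrm{sig}(\mathcal{T}_1)\cap\mathrm{sig}(\mathcal{T}_2)=\Delta$ and any $\varphi\in\mathcal{L}$ with $\mathcal{T}_1\cup\mathcal{T}_2\models\varphi$,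 there are sets of formulas $\mathcal{T}_1',\mathcal{T}_2'$ in $\mathcal{L}$ with $\mathcal{T}_i\models\mathcal{T}_i'$ ($i=1,2$), $\mathcal{T}_1'\cup\mathcal{T}_2'\models\varphi$, and $\mathrm{sig}(\mathcal{T}_i')\setminus\Delta\subseteq(\mathrm{sig}(\mathcal{T}_i)\cap\mathrm{sig}(\varphi))\setminus\Delta$. Forgetting a signature: for structures $\mathcal{M},\mathcal{M}'$ write $\mathcal{M}\sim_\sigma\mathcal{M}'$ if they have the same domain for each sort and interpret all symbols not in $\sigma$ identically. $\mathrm{forget}(\mathcal{T},\sigma)$ denotes a set of formulas (in a fragment of second-order logic), determined up to equivalence, such that for every structure $\mathcal{M}'$: $\mathcal{M}'\models\mathrm{forget}(\mathcal{T},\sigma)$ iff there is $\mathcal{M}\models\mathcal{T}$ with $\mathcal{M}\sim_\sigma\mathcal{M}'$.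
   Formalization: forget(T,σ) is also required to contain no symbol of σ, without which the claim fails for arbitrary sets of sentences L; all structures have domains inside one arbitrary carrier set, and a sufficiently large carrier recovers entailment over all structures. *)

theory Defs
  imports Main "HOL-Library.FuncSet"
begin

section \<open>Many-sorted second-order logic\<close>

text \<open>
  Symbols carry their rank.  Constants are nullary function symbols and
  propositional letters nullary predicate symbols.  Sorts belong to the fixed
  background and are not symbols of a signature.
\<close>

datatype ('s, 'f) fsym = FSym 'f (fargs: "'s list") (fres: 's)
datatype ('s, 'p) psym = PSym 'p (pargs: "'s list")

type_synonym ('s, 'f, 'p) symbol = "('s, 'f) fsym + ('s, 'p) psym"

datatype 's var = IVar nat 's | FVar "('s, nat) fsym" | PVar "('s, nat) psym"

datatype ('s, 'f) trm =
    Var nat 's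
  | Fun "('s, 'f) fsym" "('s, 'f) trm list"
  | VFun "('s, nat) fsym" "('s, 'f) trm list"

datatype ('s, 'f, 'p) fm =
    Bot
  | Top
  | Eql "('s, 'f) trm" "('s, 'f) trm"
  | Prd "('s, 'p) psym" "('s, 'f) trm list"
  | VPrd "('s, nat) psym" "('s, 'f) trm list"
  | Neg "('s, 'f, 'p) fm"
  | Con "('s, 'f, 'p) fm" "('s, 'f, 'p) fm"
  | Dis "('s, 'f, 'p) fm" "('s, 'f, 'p) fm"
  | Imp "('s, 'f, 'p) fm" "('s, 'f, 'p) fm"
  | Iff "('s, 'f, 'p) fm" "('s, 'f, 'p) fm"
  | All "'s var" "('s, 'f, 'p) fm"
  | Exi "'s var" "('s, 'f, 'p) fm"

primrec sort_of :: "('s, 'f) trm \<Rightarrow> 's" where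
  "sort_of (Var n s) = s"
| "sort_of (Fun f ts) = fres f"
| "sort_of (VFun g ts) = fres g"

primrec wf_trm :: "('s, 'f) trm \<Rightarrow> bool" where
  "wf_trm (Var n s) \<longleftrightarrow> True"
| "wf_trm (Fun f ts) \<longleftrightarrow> map sort_of ts = fargs f \<and> list_all id (map wf_trm ts)"
| "wf_trm (VFun g ts) \<longleftrightarrow> map sort_of ts = fargs g \<and> list_all id (map wf_trm ts)"

primrec wf_fm :: "('s, 'f, 'p) fm \<Rightarrow> bool" where
  "wf_fm Bot \<longleftrightarrow> True"
| "wf_fm Top \<longleftrightarrow> True"
| "wf_fm (Eql t u) \<longleftrightarrow> wf_trm t \<and> wf_trm u \<and> sort_of t = sort_of u"
| "wf_fm (Prd p ts) \<longleftrightarrow> map sort_of ts = pargs p \<and> list_all wf_trm ts"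
| "wf_fm (VPrd q ts) \<longleftrightarrow> map sort_of ts = pargs q \<and> list_all wf_trm ts"
| "wf_fm (Neg \<phi>) \<longleftrightarrow> wf_fm \<phi>"
| "wf_fm (Con \<phi> \<psi>) \<longleftrightarrow> wf_fm \<phi> \<and> wf_fm \<psi>"
| "wf_fm (Dis \<phi> \<psi>) \<longleftrightarrow> wf_fm \<phi> \<and> wf_fm \<psi>"
| "wf_fm (Imp \<phi> \<psi>) \<longleftrightarrow> wf_fm \<phi> \<and> wf_fm \<psi>"
| "wf_fm (Iff \<phi> \<psi>) \<longleftrightarrow> wf_fm \<phi> \<and> wf_fm \<psi>"
| "wf_fm (All x \<phi>) \<longleftrightarrow> wf_fm \<phi>"
| "wf_fm (Exi x \<phi>) \<longleftrightarrow> wf_fm \<phi>"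

primrec fv_trm :: "('s, 'f) trm \<Rightarrow> 's var set" where
  "fv_trm (Var n s) = {IVar n s}"
| "fv_trm (Fun f ts) = \<Union>(set (map fv_trm ts))"
| "fv_trm (VFun g ts) = insert (FVar g) (\<Union>(set (map fv_trm ts)))"

primrec fv :: "('s, 'f, 'p) fm \<Rightarrow> 's var set" where
  "fv Bot = {}"
| "fv Top = {}"
| "fv (Eql t u) = fv_trm t \<union> fv_trm u"
| "fv (Prd p ts) = \<Union>(fv_trm ` set ts)"
| "fv (VPrd q ts) = insert (PVar q) (\<Union>(fv_trm ` set ts))"
| "fv (Neg \<phi>) = fv \<phi>"
| "fv (Con \<phi> \<psi>) = fv \<phi> \<union> fv \<psi>"
| "fv (Dis \<phi> \<psi>) = fv \<phi> \<union> fv \<psi>"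
| "fv (Imp \<phi> \<psi>) = fv \<phi> \<union> fv \<psi>"
| "fv (Iff \<phi> \<psi>) = fv \<phi> \<union> fv \<psi>"
| "fv (All x \<phi>) = fv \<phi> - {x}"
| "fv (Exi x \<phi>) = fv \<phi> - {x}"

definition sentence :: "('s, 'f, 'p) fm \<Rightarrow> bool" where
  "sentence \<phi> \<longleftrightarrow> wf_fm \<phi> \<and> fv \<phi> = {}"

primrec fsyms_trm :: "('s, 'f) trm \<Rightarrow> ('s, 'f) fsym set" where
  "fsyms_trm (Var n s) = {}"
| "fsyms_trm (Fun f ts) = insert f (\<Union>(set (map fsyms_trm ts)))"
| "fsyms_trm (VFun g ts) = \<Union>(set (map fsyms_trm ts))"

primrec sig :: "('s, 'f, 'p) fm \<Rightarrow> ('s, 'f, 'p) symbol set" where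
  "sig Bot = {}"
| "sig Top = {}"
| "sig (Eql t u) = Inl ` (fsyms_trm t \<union> fsyms_trm u)"
| "sig (Prd p ts) = insert (Inr p) (Inl ` \<Union>(fsyms_trm ` set ts))"
| "sig (VPrd q ts) = Inl ` \<Union>(fsyms_trm ` set ts)"
| "sig (Neg \<phi>) = sig \<phi>"
| "sig (Con \<phi> \<psi>) = sig \<phi> \<union> sig \<psi>"
| "sig (Dis \<phi> \<psi>) = sig \<phi> \<union> sig \<psi>"
| "sig (Imp \<phi> \<psi>) = sig \<phi> \<union> sig \<psi>"
| "sig (Iff \<phi> \<psi>) = sig \<phi> \<union> sig \<psi>"
| "sig (All x \<phi>) = sig \<phi>"
| "sig (Exi x \<phi>) = sig \<phi>"

definition sigs :: "('s, 'f, 'p) fm set \<Rightarrow> ('s, 'f, 'p) symbol set" where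
  "sigs T = \<Union>(sig ` T)"


section \<open>Standard semantics\<close>

text \<open>
  Domains are nonempty subsets of the carrier type \<open>'u\<close>, chosen independently for
  each sort.  HOL cannot quantify over carrier types inside a formula, so the
  notions below that range over all structures take \<open>'u\<close> as a parameter, passed as
  an argument of type \<open>'u itself\<close>.
  Function interpretations are extensional, so that two structures with the same
  domains interpret a symbol identically iff their components at it are equal.
\<close>

record ('s, 'f, 'p, 'u) struct =
  dom :: "'s \<Rightarrow> 'u set"
  fint :: "('s, 'f) fsym \<Rightarrow> 'u list \<Rightarrow> 'u"
  pint :: "('s, 'p) psym \<Rightarrow> 'u list set"

definition tuples :: "('s \<Rightarrow> 'u set) \<Rightarrow> 's list \<Rightarrow> 'u list set" where
  "tuples D ss = listset (map D ss)"

definition funcs :: "('s \<Rightarrow> 'u set) \<Rightarrow> ('s, 'n) fsym \<Rightarrow> ('u list \<Rightarrow> 'u) set" where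
  "funcs D f = (tuples D (fargs f) \<rightarrow>\<^sub>E D (fres f))"

definition rels :: "('s \<Rightarrow> 'u set) \<Rightarrow> ('s, 'n) psym \<Rightarrow> 'u list set set" where
  "rels D p = Pow (tuples D (pargs p))"

definition is_structure :: "('s, 'f, 'p, 'u) struct \<Rightarrow> bool" where
  "is_structure M \<longleftrightarrow>
     (\<forall>s. dom M s \<noteq> {}) \<and>
     (\<forall>f. fint M f \<in> funcs (dom M) f) \<and>
     (\<forall>p. pint M p \<in> rels (dom M) p)"

record ('s, 'u) assignment =
  ival :: "nat \<Rightarrow> 's \<Rightarrow> 'u"
  fval :: "('s, nat) fsym \<Rightarrow> 'u list \<Rightarrow> 'u"
  pval :: "('s, nat) psym \<Rightarrow> 'u list set"

definition assignments :: "('s, 'f, 'p, 'u) struct \<Rightarrow> ('s, 'u) assignment set" where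
  "assignments M =
     {v. (\<forall>n s. ival v n s \<in> dom M s) \<and>
         (\<forall>g. fval v g \<in> funcs (dom M) g) \<and>
         (\<forall>q. pval v q \<in> rels (dom M) q)}"

text \<open>
  Second-order variables range over all functions and relations of their rank
  (full semantics).
\<close>

primrec variants ::
  "('s, 'f, 'p, 'u) struct \<Rightarrow> 's var \<Rightarrow> ('s, 'u) assignment \<Rightarrow> ('s, 'u) assignment set" where
  "variants M (IVar n s) v =
     {v\<lparr>ival := (ival v)(n := (ival v n)(s := a))\<rparr> | a. a \<in> dom M s}"
| "variants M (FVar g) v = {v\<lparr>fval := (fval v)(g := h)\<rparr> | h. h \<in> funcs (dom M) g}"
| "variants M (PVar q) v = {v\<lparr>pval := (pval v)(q := r)\<rparr> | r. r \<in> rels (dom M) q}"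

primrec eval :: "('s, 'f, 'p, 'u) struct \<Rightarrow> ('s, 'u) assignment \<Rightarrow> ('s, 'f) trm \<Rightarrow> 'u" where
  "eval M v (Var n s) = ival v n s"
| "eval M v (Fun f ts) = fint M f (map (eval M v) ts)"
| "eval M v (VFun g ts) = fval v g (map (eval M v) ts)"

primrec sat :: "('s, 'f, 'p, 'u) struct \<Rightarrow> ('s, 'u) assignment \<Rightarrow> ('s, 'f, 'p) fm \<Rightarrow> bool" where
  "sat M v Bot \<longleftrightarrow> False"
| "sat M v Top \<longleftrightarrow> True"
| "sat M v (Eql t u) \<longleftrightarrow> eval M v t = eval M v u"
| "sat M v (Prd p ts) \<longleftrightarrow> map (eval M v) ts \<in> pint M p"
| "sat M v (VPrd q ts) \<longleftrightarrow> map (eval M v) ts \<in> pval v q"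
| "sat M v (Neg \<phi>) \<longleftrightarrow> \<not> sat M v \<phi>"
| "sat M v (Con \<phi> \<psi>) \<longleftrightarrow> sat M v \<phi> \<and> sat M v \<psi>"
| "sat M v (Dis \<phi> \<psi>) \<longleftrightarrow> sat M v \<phi> \<or> sat M v \<psi>"
| "sat M v (Imp \<phi> \<psi>) \<longleftrightarrow> (sat M v \<phi> \<longrightarrow> sat M v \<psi>)"
| "sat M v (Iff \<phi> \<psi>) \<longleftrightarrow> (sat M v \<phi> \<longleftrightarrow> sat M v \<psi>)"
| "sat M v (All x \<phi>) \<longleftrightarrow> (\<forall>w \<in> variants M x v. sat M w \<phi>)"
| "sat M v (Exi x \<phi>) \<longleftrightarrow> (\<exists>w \<in> variants M x v. sat M w \<phi>)"

definition models :: "('s, 'f, 'p, 'u) struct \<Rightarrow> ('s, 'f, 'p) fm set \<Rightarrow> bool" where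
  "models M T \<longleftrightarrow> (\<forall>\<phi> \<in> T. \<forall>v \<in> assignments M. sat M v \<phi>)"

definition entails ::
  "'u itself \<Rightarrow> ('s, 'f, 'p) fm set \<Rightarrow> ('s, 'f, 'p) fm set \<Rightarrow> bool" where
  "entails U T T' \<longleftrightarrow>
     (\<forall>M :: ('s, 'f, 'p, 'u) struct. is_structure M \<longrightarrow> models M T \<longrightarrow> models M T')"


section \<open>Inseparability, parallel interpolation, forgetting\<close>

text \<open>A fragment of second-order logic is just a set of sentences.\<close>

definition logic :: "('s, 'f, 'p) fm set \<Rightarrow> bool" where
  "logic L \<longleftrightarrow> (\<forall>\<phi> \<in> L. sentence \<phi>)"

definition consequences ::
  "'u itself \<Rightarrow> ('s, 'f, 'p) fm set \<Rightarrow> ('s, 'f, 'p) fm set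
    \<Rightarrow> ('s, 'f, 'p) symbol set \<Rightarrow> ('s, 'f, 'p) fm set" where
  "consequences U L T \<Delta> = {\<phi> \<in> L. entails U T {\<phi>} \<and> sig \<phi> \<subseteq> \<Delta>}"

definition inseparable ::
  "'u itself \<Rightarrow> ('s, 'f, 'p) fm set \<Rightarrow> ('s, 'f, 'p) symbol set
    \<Rightarrow> ('s, 'f, 'p) fm set \<Rightarrow> ('s, 'f, 'p) fm set \<Rightarrow> bool" where
  "inseparable U L \<Delta> T1 T2 \<longleftrightarrow> consequences U L T1 \<Delta> = consequences U L T2 \<Delta>"

definition PIP :: "'u itself \<Rightarrow> ('s, 'f, 'p) fm set \<Rightarrow> bool" where
  "PIP U L \<longleftrightarrow>
     (\<forall>T1 T2 \<Delta> \<phi>.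
        T1 \<subseteq> L \<and> T2 \<subseteq> L \<and> sigs T1 \<inter> sigs T2 = \<Delta> \<and> \<phi> \<in> L \<and> entails U (T1 \<union> T2) {\<phi>} \<longrightarrow>
        (\<exists>T1' T2'.
           T1' \<subseteq> L \<and> T2' \<subseteq> L \<and>
           entails U T1 T1' \<and> entails U T2 T2' \<and>
           entails U (T1' \<union> T2') {\<phi>} \<and>
           sigs T1' - \<Delta> \<subseteq> (sigs T1 \<inter> sig \<phi>) - \<Delta> \<and>
           sigs T2' - \<Delta> \<subseteq> (sigs T2 \<inter> sig \<phi>) - \<Delta>))"

definition same_outside ::
  "('s, 'f, 'p) symbol set \<Rightarrow> ('s, 'f, 'p, 'u) struct \<Rightarrow> ('s, 'f, 'p, 'u) struct \<Rightarrow> bool" where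
  "same_outside \<sigma> M M' \<longleftrightarrow>
     dom M = dom M' \<and>
     (\<forall>f. Inl f \<notin> \<sigma> \<longrightarrow> fint M f = fint M' f) \<and>
     (\<forall>p. Inr p \<notin> \<sigma> \<longrightarrow> pint M p = pint M' p)"

text \<open>
  \<open>is_forget U T \<sigma> F\<close>: the set \<open>F\<close> is a representative of \<open>forget(T, \<sigma>)\<close>.  It need not
  exist for infinite \<open>T\<close> or \<open>\<sigma>\<close> and is unique only up to equivalence, hence a relation.
  As usual for forgetting, \<open>F\<close> is written without the forgotten symbols.  The semantic
  condition makes \<open>F\<close> independent of them but does not exclude vacuous occurrences
  such as \<open>P \<or> \<not> P\<close>, and since a logic is an arbitrary set of sentences, such
  occurrences need not be removable within the logic.
\<close>

definition is_forget ::
  "'u itself \<Rightarrow> ('s, 'f, 'p) fm set \<Rightarrow> ('s, 'f, 'p) symbol set \<Rightarrow> ('s, 'f, 'p) fm set \<Rightarrow> bool" where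
  "is_forget U T \<sigma> F \<longleftrightarrow>
     (\<forall>\<phi> \<in> F. sentence \<phi>) \<and>
     sigs F \<inter> \<sigma> = {} \<and>
     (\<forall>M' :: ('s, 'f, 'p, 'u) struct. is_structure M' \<longrightarrow>
        (models M' F \<longleftrightarrow> (\<exists>M. is_structure M \<and> models M T \<and> same_outside \<sigma> M M')))"

end

theory Submission
  imports Defs
begin

text \<open>
  Interpolating a consequence \<open>\<phi>\<close> of \<open>F1\<close> against the empty theory yields a set \<open>I\<close> of
  consequences of \<open>F1\<close> over \<open>sigs F1 \<inter> sig \<phi>\<close>, hence over \<open>\<Delta> - \<sigma>\<close>, that still entails \<open>\<phi>\<close>.
  Since \<open>T1\<close> entails \<open>F1\<close>, inseparability carries \<open>I\<close> over to \<open>T2\<close>; and a consequence of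
  \<open>T2\<close> free of \<open>\<sigma>\<close> survives forgetting \<open>\<sigma>\<close>, so \<open>F2\<close> entails \<open>I\<close> and therefore \<open>\<phi>\<close>.
\<close>

lemma eval_same_outside:
  assumes "same_outside \<sigma> M M'" and "Inl ` fsyms_trm t \<inter> \<sigma> = {}"
  shows "eval M v t = eval M' v t"
  using assms(2)
proof (induction t)
  case (Var n s)
  then show ?case by simp
next
  case (Fun f ts)
  then have "map (eval M v) ts = map (eval M' v) ts"
    by (auto simp: image_Un image_UN)
  with Fun.prems assms(1) show ?case
    by (simp add: same_outside_def del: map_eq_conv)
next
  case (VFun g ts)
  then have "map (eval M v) ts = map (eval M' v) ts"
    by (auto simp: image_Un image_UN)
  then show ?case
    by (simp del: map_eq_conv)
qed

text \<open>Quantified variables of every kind range over elements, functions or relations of the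
  domains alone, and \<open>same_outside\<close> keeps the domains fixed. This settles the
  quantifier cases below.\<close>

lemma variants_same_outside:
  assumes "same_outside \<sigma> M M'"
  shows "variants M x v = variants M' x v"
  using assms by (cases x) (simp_all add: same_outside_def)

lemma map_eval_same_outside:
  assumes "same_outside \<sigma> M M'" and "Inl ` \<Union>(fsyms_trm ` set ts) \<inter> \<sigma> = {}"
  shows "map (eval M v) ts = map (eval M' v) ts"
  using assms(2) by (auto intro!: eval_same_outside[OF assms(1)])

lemma sat_same_outside:
  assumes "same_outside \<sigma> M M'" and "sig \<phi> \<inter> \<sigma> = {}"
  shows "sat M v \<phi> \<longleftrightarrow> sat M' v \<phi>"
  using assms(2)
proof (induction \<phi> arbitrary: v)
  case (Eql t u)
  then have "eval M v t = eval M' v t" "eval M v u = eval M' v u"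
    by (auto intro!: eval_same_outside[OF assms(1)])
  then show ?case by simp
next
  case (Prd p ts)
  then have "map (eval M v) ts = map (eval M' v) ts"
    by (intro map_eval_same_outside[OF assms(1)]) auto
  with Prd assms(1) show ?case
    by (simp add: same_outside_def del: map_eq_conv)
next
  case (VPrd q ts)
  then have "map (eval M v) ts = map (eval M' v) ts"
    by (intro map_eval_same_outside[OF assms(1)]) auto
  then show ?case by (simp del: map_eq_conv)
qed (simp_all add: variants_same_outside[OF assms(1)] Int_Un_distrib2)

lemma models_same_outside:
  assumes "same_outside \<sigma> M M'" and "sigs T \<inter> \<sigma> = {}"
  shows "models M T \<longleftrightarrow> models M' T"
proof -
  have "assignments M = assignments M'"
    using assms(1) by (simp add: assignments_def same_outside_def)
  moreover have "sat M v \<phi> \<longleftrightarrow> sat M' v \<phi>" if "\<phi> \<in> T" for v \<phi>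
    using assms that by (intro sat_same_outside) (auto simp: sigs_def)
  ultimately show ?thesis
    by (simp add: models_def)
qed

lemma entails_trans: "entails U T T' \<Longrightarrow> entails U T' T'' \<Longrightarrow> entails U T T''"
  by (simp add: entails_def)

text \<open>Links the interpolants of \<open>PIP\<close>, which are sets, to
  \<open>consequences\<close>, which collects single formulas.\<close>

lemma entails_iff_singletons: "entails U T T' \<longleftrightarrow> (\<forall>\<phi> \<in> T'. entails U T {\<phi>})"
  by (auto simp: entails_def models_def)

text \<open>With \<open>{}\<close> as second theory the shared signature is empty, so the bound in
  \<open>PIP\<close> restricts every symbol of the interpolant and not only those outside a common
  part.\<close>

lemma PIP_interpolant:
  assumes "PIP U L" and "T \<subseteq> L" and "\<phi> \<in> L" and "entails U T {\<phi>}"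
  obtains I where "I \<subseteq> L" and "entails U T I" and "entails U I {\<phi>}"
    and "sigs I \<subseteq> sigs T \<inter> sig \<phi>"
proof -
  have "\<exists>I J. I \<subseteq> L \<and> J \<subseteq> L \<and> entails U T I \<and> entails U {} J \<and> entails U (I \<union> J) {\<phi>} \<and>
      sigs I - {} \<subseteq> (sigs T \<inter> sig \<phi>) - {} \<and> sigs J - {} \<subseteq> (sigs {} \<inter> sig \<phi>) - {}"
    using assms by (intro assms(1)[unfolded PIP_def, rule_format]) (simp add: sigs_def)
  then obtain I J where IJ: "I \<subseteq> L" "entails U T I" "entails U {} J" "entails U (I \<union> J) {\<phi>}"
    "sigs I \<subseteq> sigs T \<inter> sig \<phi>" by auto
  have "entails U I {\<phi>}"
    using IJ(3,4) by (auto simp: entails_def models_def)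
  with IJ show thesis using that by blast
qed

text \<open>A model of \<open>T\<close> is its own witness, since \<open>same_outside\<close> is
  reflexive.\<close>

lemma entails_is_forget:
  fixes U :: "'u itself" and T F :: "('s, 'f, 'p) fm set"
  assumes "is_forget U T \<sigma> F"
  shows "entails U T F"
proof -
  have "same_outside \<sigma> M M" for M :: "('s, 'f, 'p, 'u) struct"
    by (simp add: same_outside_def)
  with assms show ?thesis
    unfolding entails_def is_forget_def by blast
qed

text \<open>A model of \<open>F\<close> agrees outside \<open>\<sigma>\<close> with some model of
  \<open>T\<close>; the latter satisfies \<open>I\<close>, and \<open>I\<close> cannot tell the two
  apart.\<close>

lemma is_forget_entails:
  assumes "is_forget U T \<sigma> F" and "entails U T I" and "sigs I \<inter> \<sigma> = {}"
  shows "entails U F I"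
  using assms unfolding is_forget_def entails_def by (metis models_same_outside)

lemma consequences_is_forget_subset:
  assumes "PIP U L" and "inseparable U L \<Delta> T1 T2"
    and "is_forget U T1 \<sigma> F1" and "is_forget U T2 \<sigma> F2" and "F1 \<subseteq> L"
  shows "consequences U L F1 \<Delta> \<subseteq> consequences U L F2 \<Delta>"
proof
  fix \<phi> assume "\<phi> \<in> consequences U L F1 \<Delta>"
  then have \<phi>: "\<phi> \<in> L" "entails U F1 {\<phi>}" "sig \<phi> \<subseteq> \<Delta>"
    by (simp_all add: consequences_def)
  obtain I where I: "I \<subseteq> L" "entails U F1 I" "entails U I {\<phi>}" "sigs I \<subseteq> sigs F1 \<inter> sig \<phi>"
    using PIP_interpolant[OF assms(1,5) \<phi>(1,2)] .
  have "entails U T1 I"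
    using entails_is_forget[OF assms(3)] I(2) by (rule entails_trans)
  then have "I \<subseteq> consequences U L T1 \<Delta>"
    using I(1,4) \<phi>(3) entails_iff_singletons[of U T1 I]
    by (auto simp: consequences_def sigs_def)
  then have "I \<subseteq> consequences U L T2 \<Delta>"
    using assms(2) by (simp add: inseparable_def)
  then have "entails U T2 I"
    using entails_iff_singletons[of U T2 I] by (auto simp: consequences_def)
  \<comment> \<open>This comes from \<open>F1\<close>, not from \<open>\<phi>\<close>, which may
    itself mention symbols of \<open>\<sigma>\<close>; hence the detour through
    \<open>I\<close>.\<close>
  moreover have "sigs I \<inter> \<sigma> = {}"
    using I(4) assms(3) by (auto simp: is_forget_def)
  ultimately have "entails U F2 I"
    by (rule is_forget_entails[OF assms(4)])
  then have "entails U F2 {\<phi>}"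
    using I(3) by (rule entails_trans)
  with \<phi> show "\<phi> \<in> consequences U L F2 \<Delta>"
    by (simp add: consequences_def)
qed

theorem proposition3p7:
  fixes U :: "'u itself"
    and L T1 T2 F1 F2 :: "('s, 'f, 'p) fm set"
    and \<Delta> \<sigma> :: "('s, 'f, 'p) symbol set"
  assumes "logic L"
    and "PIP U L"
    and "T1 \<subseteq> L" and "T2 \<subseteq> L"
    and "sigs T1 \<inter> sigs T2 = \<Delta>"
    and "inseparable U L \<Delta> T1 T2"
    and "\<sigma> \<subseteq> \<Delta>"
    and "is_forget U T1 \<sigma> F1" and "is_forget U T2 \<sigma> F2"
    and "F1 \<subseteq> L" and "F2 \<subseteq> L"
  shows "inseparable U L \<Delta> F1 F2"
proof -
  have "inseparable U L \<Delta> T2 T1"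
    using assms(6) by (simp add: inseparable_def)
  then have "consequences U L F2 \<Delta> \<subseteq> consequences U L F1 \<Delta>"
    using assms by (intro consequences_is_forget_subset)
  moreover have "consequences U L F1 \<Delta> \<subseteq> consequences U L F2 \<Delta>"
    using assms by (intro consequences_is_forget_subset)
  ultimately show ?thesis
    by (simp add: inseparable_def)
qed

end
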